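(* For every $\varepsilon>0$ there is a constant $C=C(\varepsilon)$ such that the following holds: if $G$ is an $(r,t)$-Ruzsa–Szemerédi graph on $n$ vertices with $r=cn$ where $1/5+\varepsilon \le c < 1/4$, then $t \le C n/\log n$.
   Context: All graphs are finite and simple. A matching $M$ in a graph $G$ is an induced matching if the subgraph of $G$ induced on the set of vertices covered by $M$ has edge set exactly $M$. A graph $G$ is an $(r,t)$-Ruzsa–Szemerédi graph if its edge set can be partitioned into $t$ pairwise edge-disjoint induced matchings, each consisting of exactly $r$ edges. *)

theory Defs
  imports Complex_Main "HOL-Library.Disjoint_Sets"
begin

definition simple_graph :: "'a set \<Rightarrow> 'a set set \<Rightarrow> bool" where
  "simple_graph V E \<longleftrightarrow> finite V \<and> E \<subseteq> {e. e \<subseteq> V \<and> card e = 2}"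

definition induced_edges :: "'a set set \<Rightarrow> 'a set \<Rightarrow> 'a set set" where
  "induced_edges E S = {e \<in> E. e \<subseteq> S}"

definition matching :: "'a set set \<Rightarrow> 'a set set \<Rightarrow> bool" where
  "matching E M \<longleftrightarrow> M \<subseteq> E \<and> disjoint M"

definition induced_matching :: "'a set set \<Rightarrow> 'a set set \<Rightarrow> bool" where
  "induced_matching E M \<longleftrightarrow> matching E M \<and> induced_edges E (\<Union>M) = M"

(* The parts of a partition are nonempty, so for r = 0 only t = 0 and E = {} is possible. *)
definition RS_graph :: "nat \<Rightarrow> nat \<Rightarrow> 'a set \<Rightarrow> 'a set set \<Rightarrow> bool" where
  "RS_graph r t V E \<longleftrightarrow> simple_graph V E \<and>
     (\<exists>P. partition_on E P \<and> card P = t \<and> (\<forall>M\<in>P. induced_matching E M \<and> card M = r))"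

end

theory Submission
  imports Defs
begin

text \<open>
  Write \<open>A\<^sub>M\<close> for the set of vertices covered by a matching \<open>M\<close> of the decomposition. Inducedness gives
  \<open>|A\<^sub>M \<inter> A\<^sub>M\<^sub>'| \<le> r\<close> for distinct matchings, and if \<open>v \<in> A\<^sub>M\<close> then \<open>A\<^sub>M\<close> contains only one
  neighbour of \<open>v\<close>. Hence, restricting to the matchings through a vertex \<open>v\<close>, one may essentially
  discard the neighbourhood of \<open>v\<close> from the vertex set. Repeat this with vertices \<open>v\<close> that
  have at least \<open>\<delta>t\<close> neighbours in the set \<open>W\<close> of vertices left and lie in at least a
  \<open>\<delta>\<close>-fraction of the matchings left: about \<open>log n\<close> rounds are possible before the family of
  matchings is exhausted, and each discards at least \<open>\<delta>t\<close> new vertices, so \<open>t log n = O(n)\<close>.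

  Such a \<open>v\<close> always exists: otherwise let \<open>L\<close> be the set of vertices in \<open>W\<close> with fewer than
  \<open>\<delta>t\<close> neighbours in \<open>W\<close>. Almost every edge meets the complement of \<open>L\<close>, so
  \<open>cn \<le> n - |L| + \<delta>n\<close>. But the remaining sets \<open>A\<^sub>M\<close> lie almost entirely in \<open>L\<close>, have size \<open>2cn\<close> and
  pairwise intersections at most \<open>cn\<close>, so a second moment argument gives
  \<open>|L| \<ge> 4cn - O(\<delta>n)\<close>. Together, \<open>5c \<le> 1 + O(\<delta>)\<close>.
\<close>

section \<open>A second moment inequality for set families\<close>

lemma sum_of_bool_mem:
  assumes "finite L"
  shows "(\<Sum>v\<in>L. of_bool (v \<in> B)) = real (card (B \<inter> L))"
  using assms by (simp add: of_bool_def sum.If_cases Int_commute)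

text \<open>Expand the sum over \<open>v \<in> L\<close> of
  \<open>(2 * x v - card F)\<^sup>2 \<ge> 0\<close>, where \<open>x v\<close> counts the sets
  containing \<open>v\<close>. The centre \<open>card F / 2\<close> suits sets of size 2r with
  pairwise intersections of size r, where the ratio of the second to the first moment of
  \<open>x\<close> is about \<open>card F / 2\<close>.\<close>

lemma second_moment_card_ge:
  fixes A :: "'i \<Rightarrow> 'a set"
  assumes "finite F" "finite L"
  shows "4 * (real (card F) * (\<Sum>i\<in>F. real (card (A i \<inter> L)))
            - (\<Sum>i\<in>F. \<Sum>j\<in>F. real (card (A i \<inter> A j \<inter> L)))) \<le> (real (card F))\<^sup>2 * real (card L)"
proof -
  define x where "x v = (\<Sum>i\<in>F. of_bool (v \<in> A i) :: real)" for v
  note card_eq = sum_of_bool_mem[OF assms(2)]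
  have first: "(\<Sum>v\<in>L. x v) = (\<Sum>i\<in>F. real (card (A i \<inter> L)))"
    unfolding x_def card_eq[symmetric] by (rule sum.swap)
  have "(\<Sum>v\<in>L. (x v)\<^sup>2) = (\<Sum>v\<in>L. \<Sum>i\<in>F. \<Sum>j\<in>F. of_bool (v \<in> A i \<inter> A j))"
    by (simp add: x_def power2_eq_square sum_product flip: of_bool_conj)
  also have "\<dots> = (\<Sum>i\<in>F. \<Sum>v\<in>L. \<Sum>j\<in>F. of_bool (v \<in> A i \<inter> A j))"
    by (rule sum.swap)
  also have "\<dots> = (\<Sum>i\<in>F. \<Sum>j\<in>F. real (card (A i \<inter> A j \<inter> L)))"
    unfolding card_eq[symmetric] by (intro sum.cong refl sum.swap)
  finally have second: "(\<Sum>v\<in>L. (x v)\<^sup>2) = (\<Sum>i\<in>F. \<Sum>j\<in>F. real (card (A i \<inter> A j \<inter> L)))" .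
  have "0 \<le> (\<Sum>v\<in>L. (2 * x v - real (card F))\<^sup>2)"
    by (simp add: sum_nonneg)
  also have "\<dots> = (\<Sum>v\<in>L. 4 * (x v)\<^sup>2 - 4 * real (card F) * x v + (real (card F))\<^sup>2)"
    by (intro sum.cong refl) (simp add: power2_eq_square algebra_simps)
  also have "\<dots> = 4 * (\<Sum>v\<in>L. (x v)\<^sup>2) - 4 * real (card F) * (\<Sum>v\<in>L. x v)
                   + (real (card F))\<^sup>2 * real (card L)"
    by (simp add: sum.distrib sum_subtractf flip: sum_distrib_left)
  finally show ?thesis
    by (simp add: first second algebra_simps)
qed

section \<open>Consequences of inducedness\<close>

definition nbhd :: "'a set set \<Rightarrow> 'a \<Rightarrow> 'a set" where
  "nbhd E v = {u. {v, u} \<in> E}"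

locale RS_decomposition =
  fixes V :: "'a set" and E :: "'a set set" and P :: "'a set set set" and r :: nat
  assumes simple: "simple_graph V E"
    and partition: "partition_on E P"
    and induced: "M \<in> P \<Longrightarrow> induced_matching E M"
    and size: "M \<in> P \<Longrightarrow> card M = r"
begin

lemma finite_V: "finite V"
  using simple by (simp add: simple_graph_def)

lemma edge_subset: "e \<in> E \<Longrightarrow> e \<subseteq> V"
  and card_edge: "e \<in> E \<Longrightarrow> card e = 2"
  using simple by (auto simp: simple_graph_def)

lemma finite_edge: "e \<in> E \<Longrightarrow> finite e"
  using edge_subset finite_V finite_subset by blast

lemma finite_E: "finite E"
  using finite_V edge_subset by (meson Pow_iff finite_Pow_iff finite_subset subsetI)

lemma finite_P: "finite P"
  using partition finite_E by (simp add: finite_elements)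

lemma matching_subset: "M \<in> P \<Longrightarrow> M \<subseteq> E"
  and matching_disjoint: "M \<in> P \<Longrightarrow> disjoint M"
  using induced by (auto simp: induced_matching_def matching_def)

lemma finite_matching: "M \<in> P \<Longrightarrow> finite M"
  using matching_subset finite_E finite_subset by blast

lemma covered_subset: "M \<in> P \<Longrightarrow> \<Union>M \<subseteq> V"
  using matching_subset edge_subset by blast

lemma edge_in_matching: "M \<in> P \<Longrightarrow> e \<in> E \<Longrightarrow> e \<subseteq> \<Union>M \<Longrightarrow> e \<in> M"
  using induced unfolding induced_matching_def induced_edges_def by blast

lemma nbhd_subset: "nbhd E v \<subseteq> V"
  using edge_subset unfolding nbhd_def by blast

lemma card_covered:
  assumes "M \<in> P"
  shows "card (\<Union>M) = 2 * r"
proof -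
  have "card (\<Union>M) = (\<Sum>e\<in>M. card e)"
    using matching_disjoint[OF assms] matching_subset[OF assms] finite_edge
    by (intro card_Union_disjoint) (auto simp: disjoint_def pairwise_def disjnt_def)
  also have "\<dots> = (\<Sum>e\<in>M. 2)"
    using matching_subset[OF assms] card_edge by (intro sum.cong) auto
  finally show ?thesis
    using size[OF assms] by simp
qed

text \<open>An edge of \<open>M'\<close> with both ends in \<open>\<Union>M\<close> would lie in
  \<open>M\<close> by inducedness, but distinct parts are disjoint. So each of the r edges of
  \<open>M'\<close> contributes at most one vertex.\<close>

lemma card_covered_Int_le:
  assumes "M \<in> P" "M' \<in> P" "M \<noteq> M'"
  shows "card (\<Union>M \<inter> \<Union>M') \<le> r"
proof -
  have le1: "card (e \<inter> \<Union>M) \<le> 1" if "e \<in> M'" for e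
  proof (rule ccontr)
    assume "\<not> ?thesis"
    moreover have e: "e \<in> E"
      using that assms matching_subset by blast
    ultimately have "card e \<le> card (e \<inter> \<Union>M)"
      using card_edge by simp
    then have "e \<inter> \<Union>M = e"
      using finite_edge[OF e] by (meson Int_lower1 card_seteq)
    then have "e \<in> M"
      using edge_in_matching[OF assms(1) e] by blast
    then show False
      using partition assms that unfolding partition_on_def disjoint_def by blast
  qed
  have "\<Union>M \<inter> \<Union>M' = (\<Union>e\<in>M'. e \<inter> \<Union>M)"
    by blast
  then have "card (\<Union>M \<inter> \<Union>M') \<le> (\<Sum>e\<in>M'. card (e \<inter> \<Union>M))"
    using card_UN_le finite_matching[OF assms(2)] by metis
  also have "\<dots> \<le> (\<Sum>e\<in>M'. 1)"
    by (intro sum_mono le1)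
  finally show ?thesis
    using size[OF assms(2)] by simp
qed

text \<open>By inducedness, two neighbours of \<open>v\<close> inside \<open>\<Union>M\<close> would
  give two edges of the matching \<open>M\<close> meeting at \<open>v\<close>.\<close>

lemma card_covered_Int_nbhd_le:
  assumes "M \<in> P" "v \<in> \<Union>M"
  shows "card (\<Union>M \<inter> nbhd E v) \<le> 1"
proof -
  have "u = u'" if "u \<in> \<Union>M \<inter> nbhd E v" "u' \<in> \<Union>M \<inter> nbhd E v" for u u'
  proof -
    have "{v, u} \<in> M" "{v, u'} \<in> M"
      using that assms by (auto simp: nbhd_def intro!: edge_in_matching)
    then have "{v, u} = {v, u'}"
      using disjointD[OF matching_disjoint[OF assms(1)]] by blast
    then show ?thesis
      by (auto simp: doubleton_eq_iff)
  qed
  then show ?thesis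
    by (cases "finite (\<Union>M \<inter> nbhd E v)") (auto simp: card_le_Suc0_iff_eq)
qed

section \<open>Sets spanning few edges\<close>

lemma card_edges_inside_le:
  assumes "L \<subseteq> V" and "\<And>v. v \<in> L \<Longrightarrow> real (card (nbhd E v \<inter> L)) \<le> d"
  shows "real (card {e \<in> E. e \<subseteq> L}) \<le> real (card L) * d"
proof -
  have fin: "finite L"
    using assms(1) finite_V finite_subset by blast
  have "{e \<in> E. e \<subseteq> L} \<subseteq> (\<lambda>(v, u). {v, u}) ` (SIGMA v:L. nbhd E v \<inter> L)"
  proof
    fix e assume e: "e \<in> {e \<in> E. e \<subseteq> L}"
    then have "card e = 2"
      by (simp add: card_edge)
    then obtain v u where "e = {v, u}"
      by (auto simp: card_2_iff)
    then show "e \<in> (\<lambda>(v, u). {v, u}) ` (SIGMA v:L. nbhd E v \<inter> L)"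
      using e by (force simp: nbhd_def)
  qed
  then have "card {e \<in> E. e \<subseteq> L} \<le> card (SIGMA v:L. nbhd E v \<inter> L)"
    using fin by (intro surj_card_le) auto
  also have "\<dots> = (\<Sum>v\<in>L. card (nbhd E v \<inter> L))"
    using fin by (intro card_SigmaI) auto
  finally have "real (card {e \<in> E. e \<subseteq> L}) \<le> (\<Sum>v\<in>L. real (card (nbhd E v \<inter> L)))"
    by (metis of_nat_le_iff of_nat_sum)
  also have "\<dots> \<le> (\<Sum>v\<in>L. d)"
    by (intro sum_mono assms(2))
  finally show ?thesis
    by simp
qed

text \<open>Each edge of \<open>M\<close> not inside \<open>L\<close> has a vertex outside
  \<open>L\<close>; as edges of \<open>M\<close> are disjoint, choosing one such vertex per edge is
  injective.\<close>

lemma matching_size_le: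
  assumes "M \<in> P" "L \<subseteq> V"
  shows "r \<le> card (V - L) + card {e \<in> M. e \<subseteq> L}"
proof -
  define f where "f e = (SOME x. x \<in> e - L)" for e :: "'a set"
  have f: "f e \<in> e - L" if "e \<in> {e \<in> M. \<not> e \<subseteq> L}" for e
  proof -
    have "\<exists>x. x \<in> e - L"
      using that by blast
    then show ?thesis
      unfolding f_def by (rule someI_ex)
  qed
  have "inj_on f {e \<in> M. \<not> e \<subseteq> L}"
  proof (rule inj_onI)
    fix e e' assume e: "e \<in> {e \<in> M. \<not> e \<subseteq> L}" "e' \<in> {e \<in> M. \<not> e \<subseteq> L}" "f e = f e'"
    then have "f e \<in> e \<inter> e'"
      using f by (metis DiffD1 IntI)
    then show "e = e'"
      using e disjointD[OF matching_disjoint[OF assms(1)]] by blast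
  qed
  moreover have "f ` {e \<in> M. \<not> e \<subseteq> L} \<subseteq> V - L"
    using f covered_subset[OF assms(1)] by blast
  ultimately have "card {e \<in> M. \<not> e \<subseteq> L} \<le> card (V - L)"
    using finite_V by (meson card_inj_on_le finite_Diff)
  moreover have "card M = card {e \<in> M. e \<subseteq> L} + card {e \<in> M. \<not> e \<subseteq> L}"
    using finite_matching[OF assms(1)] by (subst card_Un_disjoint[symmetric]) (auto intro: arg_cong[where f = card])
  ultimately show ?thesis
    using size[OF assms(1)] by simp
qed

text \<open>Sum \<open>matching_size_le\<close> over \<open>P\<close>: every edge inside
  \<open>L\<close> is counted once, and by sparsity there are at most \<delta>nt of them. Dividing
  by t gives the bound.\<close>

lemma card_sparse_set_le:
  assumes "L \<subseteq> V" and "\<And>v. v \<in> L \<Longrightarrow> real (card (nbhd E v \<inter> L)) \<le> \<delta> * real (card P)"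
    and "P \<noteq> {}" "\<delta> \<ge> 0"
  shows "real (card L) \<le> (1 + \<delta>) * real (card V) - real r"
proof -
  let ?t = "real (card P)" and ?n = "real (card V)"
  have t: "?t > 0"
    using assms(3) finite_P by (simp add: card_gt_0_iff)
  have le: "card L \<le> card V"
    using assms(1) finite_V by (simp add: card_mono)
  have "(\<Union>M\<in>P. {e \<in> M. e \<subseteq> L}) = {e \<in> E. e \<subseteq> L}"
    using partition by (auto simp: partition_on_def)
  moreover have "card (\<Union>M\<in>P. {e \<in> M. e \<subseteq> L}) = (\<Sum>M\<in>P. card {e \<in> M. e \<subseteq> L})"
    using finite_P finite_matching partition
    by (intro card_UN_disjoint) (auto simp: partition_on_def disjoint_def)
  ultimately have inside: "card {e \<in> E. e \<subseteq> L} = (\<Sum>M\<in>P. card {e \<in> M. e \<subseteq> L})"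
    by simp
  have "(\<Sum>M\<in>P. r) \<le> (\<Sum>M\<in>P. card (V - L) + card {e \<in> M. e \<subseteq> L})"
    by (intro sum_mono matching_size_le assms(1))
  then have "card P * r \<le> card P * card (V - L) + card {e \<in> E. e \<subseteq> L}"
    by (simp add: sum.distrib inside)
  then have "?t * real r \<le> ?t * real (card (V - L)) + real (card {e \<in> E. e \<subseteq> L})"
    by (metis of_nat_add of_nat_le_iff of_nat_mult)
  also have "\<dots> \<le> ?t * (?n - real (card L)) + real (card L) * (\<delta> * ?t)"
    using card_edges_inside_le[OF assms(1,2)] le assms(1) finite_V
    by (simp add: card_Diff_subset finite_subset of_nat_diff)
  also have "\<dots> \<le> ?t * (?n - real (card L)) + ?n * (\<delta> * ?t)"
    using le assms(4) t by (intro add_left_mono mult_right_mono) auto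
  finally have "?t * real r \<le> ?t * ((1 + \<delta>) * ?n - real (card L))"
    by (simp add: algebra_simps)
  then show ?thesis
    using t by simp
qed

section \<open>Existence of a rich vertex\<close>

lemma exists_rich_vertex:
  assumes F: "F \<subseteq> P" "\<delta> * real (card F) \<ge> 1"
    and W: "W \<subseteq> V" "\<And>M. M \<in> F \<Longrightarrow> real (card (\<Union>M - W)) \<le> \<delta> * real (card V)"
    and \<delta>: "\<delta> > 0"
    and r: "(1 + 13 * \<delta>) * real (card V) < 5 * real r" "r \<le> card V"
  shows "\<exists>v\<in>V. real (card (nbhd E v \<inter> W)) \<ge> \<delta> * real (card P) \<and>
                real (card {M \<in> F. v \<in> \<Union>M}) \<ge> \<delta> * real (card F)"
proof (rule ccontr)
  assume contra: "\<not> ?thesis"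
  let ?n = "real (card V)" and ?f = "real (card F)"
  \<comment> \<open>\<open>H\<close> collects the vertices with many neighbours in \<open>W\<close>.
    Under \<open>contra\<close> each of them lies in fewer than \<open>\<delta> * card F\<close> of
    the sets \<open>\<Union>M\<close>, so these sets meet \<open>H\<close> in at most \<delta>n
    vertices on average.\<close>
  define H where "H = {v \<in> V. real (card (nbhd E v \<inter> W)) \<ge> \<delta> * real (card P)}"
  define L where "L = W - H"
  have finF: "finite F"
    using F(1) finite_P finite_subset by blast
  have finL: "finite L" and LV: "L \<subseteq> V" and finH: "finite H" and HV: "H \<subseteq> V"
    using W(1) finite_V by (auto simp: L_def H_def intro: finite_subset)
  have f: "?f > 0"
    using F(2) \<delta> by (cases "card F = 0") auto
  have upper: "real (card L) \<le> (1 + \<delta>) * ?n - real r"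
  proof (rule card_sparse_set_le[OF LV])
    fix v assume "v \<in> L"
    then have "real (card (nbhd E v \<inter> W)) \<le> \<delta> * real (card P)"
      using W(1) by (auto simp: L_def H_def)
    moreover have "card (nbhd E v \<inter> L) \<le> card (nbhd E v \<inter> W)"
      using finite_V nbhd_subset by (intro card_mono) (auto simp: L_def intro: finite_subset)
    ultimately show "real (card (nbhd E v \<inter> L)) \<le> \<delta> * real (card P)"
      by linarith
  qed (use F f \<delta> in auto)
  have H_le: "(\<Sum>M\<in>F. real (card (\<Union>M \<inter> H))) \<le> \<delta> * ?f * ?n"
  proof -
    have "(\<Sum>M\<in>F. real (card (\<Union>M \<inter> H))) = (\<Sum>M\<in>F. \<Sum>v\<in>H. of_bool (v \<in> \<Union>M))"
      by (simp only: sum_of_bool_mem[OF finH])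
    also have "\<dots> = (\<Sum>v\<in>H. \<Sum>M\<in>F. of_bool (v \<in> \<Union>M))"
      by (rule sum.swap)
    also have "\<dots> = (\<Sum>v\<in>H. real (card {M \<in> F. v \<in> \<Union>M}))"
      using finF by (simp add: of_bool_def sum.If_cases Int_def)
    also have "\<dots> \<le> (\<Sum>v\<in>H. \<delta> * ?f)"
      using contra by (intro sum_mono) (force simp: H_def)
    also have "\<dots> \<le> ?n * (\<delta> * ?f)"
      using \<delta> f HV finite_V by (simp add: card_mono)
    finally show ?thesis
      by (simp add: mult.commute mult.left_commute)
  qed
  have in_L: "2 * real r - \<delta> * ?n - real (card (\<Union>M \<inter> H)) \<le> real (card (\<Union>M \<inter> L))" if "M \<in> F" for M
  proof -
    have "\<Union>M \<subseteq> (\<Union>M \<inter> L) \<union> (\<Union>M \<inter> H) \<union> (\<Union>M - W)"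
      by (auto simp: L_def)
    moreover have fin: "finite (\<Union>M)"
      using that F(1) covered_subset finite_V by (meson finite_subset subsetD)
    ultimately have "card (\<Union>M) \<le> card ((\<Union>M \<inter> L) \<union> (\<Union>M \<inter> H) \<union> (\<Union>M - W))"
      by (intro card_mono) auto
    also have "\<dots> \<le> card (\<Union>M \<inter> L) + card (\<Union>M \<inter> H) + card (\<Union>M - W)"
      using card_Un_le by (meson add_le_mono1 le_trans)
    finally show ?thesis
      using W(2)[OF that] card_covered[of M] that F(1) by auto
  qed
  have "(\<Sum>M\<in>F. 2 * real r - \<delta> * ?n - real (card (\<Union>M \<inter> H))) \<le> (\<Sum>M\<in>F. real (card (\<Union>M \<inter> L)))"
    by (intro sum_mono in_L)
  then have first: "?f * (2 * real r - 2 * \<delta> * ?n) \<le> (\<Sum>M\<in>F. real (card (\<Union>M \<inter> L)))"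
    using H_le by (simp add: sum_subtractf right_diff_distrib mult_ac)
  \<comment> \<open>The diagonal pairs contribute 2r instead of r. Their total excess
    \<open>card F * r\<close> is absorbed into an error term using
    \<open>\<delta> * card F \<ge> 1\<close> and r \<le> n.\<close>
  have "(\<Sum>M\<in>F. \<Sum>M'\<in>F. real (card (\<Union>M \<inter> \<Union>M' \<inter> L))) \<le> (\<Sum>M\<in>F. \<Sum>M'\<in>F. real r + of_bool (M' = M) * real r)"
  proof (intro sum_mono)
    fix M M' assume M: "M \<in> F" "M' \<in> F"
    have "card (\<Union>M \<inter> \<Union>M' \<inter> L) \<le> card (\<Union>M \<inter> \<Union>M')"
      using finite_subset[OF covered_subset finite_V, of M] M F(1) by (intro card_mono) auto
    also have "\<dots> \<le> r + of_bool (M' = M) * r"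
      using M F(1) card_covered_Int_le[of M M'] card_covered[of M] by (cases "M = M'") auto
    finally show "real (card (\<Union>M \<inter> \<Union>M' \<inter> L)) \<le> real r + of_bool (M' = M) * real r"
      by (auto split: if_splits simp: of_bool_def)
  qed
  also have "\<dots> = ?f\<^sup>2 * real r + ?f * real r"
    using finF by (simp add: sum.distrib power2_eq_square of_bool_def if_distrib[of "\<lambda>x. x * _"]
        distrib_left mult.assoc cong: if_cong)
  also have "\<dots> \<le> ?f\<^sup>2 * real r + ?f * (\<delta> * ?f * ?n)"
    using F(2) r(2) f mult_mono[of 1 "\<delta> * ?f" "real r" ?n] by (intro add_left_mono mult_left_mono) auto
  finally have second: "(\<Sum>M\<in>F. \<Sum>M'\<in>F. real (card (\<Union>M \<inter> \<Union>M' \<inter> L))) \<le> ?f\<^sup>2 * (real r + \<delta> * ?n)"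
    by (simp add: power2_eq_square algebra_simps)
  \<comment> \<open>Three losses of \<delta>n: vertices outside \<open>W\<close>, vertices in
    \<open>H\<close>, and the diagonal. Times 4, plus the one in \<open>upper\<close>, they make the
    13 in the hypothesis.\<close>
  have "?f\<^sup>2 * (4 * (real r - 3 * \<delta> * ?n))
      = 4 * (?f * (?f * (2 * real r - 2 * \<delta> * ?n)) - ?f\<^sup>2 * (real r + \<delta> * ?n))"
    by (simp add: power2_eq_square algebra_simps)
  also have "\<dots> \<le> 4 * (?f * (\<Sum>M\<in>F. real (card (\<Union>M \<inter> L)))
            - (\<Sum>M\<in>F. \<Sum>M'\<in>F. real (card (\<Union>M \<inter> \<Union>M' \<inter> L))))"
    using first second f by (intro mult_left_mono diff_mono) auto
  also have "\<dots> \<le> ?f\<^sup>2 * real (card L)"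
    by (rule second_moment_card_ge[OF finF finL])
  finally have "4 * (real r - 3 * \<delta> * ?n) \<le> real (card L)"
    using f by simp
  then show False
    using upper r(1) by (simp add: algebra_simps)
qed

section \<open>Iterated restriction\<close>

text \<open>Each round takes a rich vertex \<open>v\<close>, keeps the matchings covering
  \<open>v\<close> and deletes its neighbourhood from \<open>W\<close>. Each kept matching loses at
  most one more covered vertex, by \<open>card_covered_Int_nbhd_le\<close>. The assumption for
  \<open>l\<close> is what \<open>exists_rich_vertex\<close> needs after \<open>l\<close>
  rounds.\<close>

lemma exists_restriction:
  assumes \<delta>: "\<delta> > 0"
    and r: "(1 + 13 * \<delta>) * real (card V) < 5 * real r" "r \<le> card V"
    and k: "\<And>l. l < k \<Longrightarrow> \<delta> ^ Suc l * real (card P) \<ge> 1 \<and> real l \<le> \<delta> * real (card V)"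
  shows "\<exists>F W. F \<subseteq> P \<and> W \<subseteq> V \<and> \<delta> ^ k * real (card P) \<le> real (card F) \<and>
           real (card W) + real k * \<delta> * real (card P) \<le> real (card V) \<and>
           (\<forall>M\<in>F. card (\<Union>M - W) \<le> k)"
  using k
proof (induction k)
  case 0
  have "card (\<Union>M - V) \<le> 0" if "M \<in> P" for M
    using covered_subset[OF that] by (metis Diff_eq_empty_iff card.empty order_refl)
  then show ?case
    by (intro exI[of _ P] exI[of _ V]) auto
next
  case (Suc k)
  then obtain F W where FW: "F \<subseteq> P" "W \<subseteq> V" "\<delta> ^ k * real (card P) \<le> real (card F)"
    "real (card W) + real k * \<delta> * real (card P) \<le> real (card V)" "\<forall>M\<in>F. card (\<Union>M - W) \<le> k"
    by (metis less_SucI)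
  have k: "\<delta> ^ Suc k * real (card P) \<ge> 1" "real k \<le> \<delta> * real (card V)"
    using Suc.prems by auto
  have mono: "\<delta> ^ Suc k * real (card P) \<le> \<delta> * real (card F)"
    using FW(3) \<delta> by (simp add: mult.assoc)
  obtain v where v: "v \<in> V" "real (card (nbhd E v \<inter> W)) \<ge> \<delta> * real (card P)"
    "real (card {M \<in> F. v \<in> \<Union>M}) \<ge> \<delta> * real (card F)"
    using exists_rich_vertex[OF FW(1) _ FW(2) _ \<delta> r] mono k FW(5) by fastforce
  define F' W' where "F' = {M \<in> F. v \<in> \<Union>M}" and "W' = W - nbhd E v"
  have finW: "finite W"
    using FW(2) finite_V finite_subset by blast
  have "card W = card W' + card (nbhd E v \<inter> W)"
    unfolding W'_def using finW by (subst card_Un_disjoint[symmetric]) (auto intro: arg_cong[where f = card])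
  then have "real (card W') + real (Suc k) * \<delta> * real (card P) \<le> real (card V)"
    using FW(4) v(2) by (simp add: algebra_simps)
  moreover have "card (\<Union>M - W') \<le> Suc k" if "M \<in> F'" for M
  proof -
    have M: "M \<in> P" "v \<in> \<Union>M" "M \<in> F"
      using that FW(1) by (auto simp: F'_def)
    have "card (\<Union>M - W') \<le> card ((\<Union>M - W) \<union> (\<Union>M \<inter> nbhd E v))"
      using finite_subset[OF covered_subset[OF M(1)] finite_V]
      by (intro card_mono) (auto simp: W'_def)
    also have "\<dots> \<le> card (\<Union>M - W) + card (\<Union>M \<inter> nbhd E v)"
      by (rule card_Un_le)
    also have "\<dots> \<le> Suc k"
      using FW(5) M card_covered_Int_nbhd_le[OF M(1,2)] by fastforce
    finally show ?thesis .
  qed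
  ultimately show ?case
    using FW(1,2) v(3) mono
    by (intro exI[of _ F'] exI[of _ W']) (auto simp: F'_def W'_def)
qed

section \<open>Logarithmically many rounds\<close>

lemma card_decomposition_le:
  assumes "0 < \<delta>" "\<delta> < 1" "0 < \<gamma>" "\<gamma> \<le> \<delta>" "\<gamma> * ln (1 / \<delta>) \<le> 1 / 2"
    and n: "card V \<ge> 2"
    and r: "(1 + 13 * \<delta>) * real (card V) < 5 * real r" "r \<le> card V"
  shows "real (card P) \<le> 2 / (\<delta> * \<gamma>) * real (card V) / ln (real (card V))"
proof -
  let ?n = "real (card V)" and ?t = "real (card P)"
  have ln_pos: "ln ?n > 0"
    using n by simp
  show ?thesis
  \<comment> \<open>Below this threshold ln n \<le> 2 sqrt n already gives the bound, which is where
    the factor 2 comes from. Above it, t is large enough to survive about \<gamma> ln n shrinkings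
    by \<delta>.\<close>
  proof (cases "?t < sqrt ?n / \<delta>")
    case True
    have "ln ?n = 2 * ln (sqrt ?n)"
      using n by (simp add: ln_sqrt)
    also have "\<dots> \<le> 2 * sqrt ?n"
      using n by (intro mult_left_mono ln_bound) auto
    finally have "sqrt ?n * ln ?n \<le> 2 * ?n"
      using mult_left_mono[of "ln ?n" "2 * sqrt ?n" "sqrt ?n"] by (simp add: mult.left_commute)
    then have "sqrt ?n / \<delta> \<le> 2 / \<delta> * ?n / ln ?n"
      using ln_pos assms(1) by (simp add: field_simps)
    also have "\<dots> \<le> 2 / (\<delta> * \<gamma>) * ?n / ln ?n"
      using ln_pos assms(1-4) by (intro divide_right_mono mult_right_mono divide_left_mono) auto
    finally show ?thesis
      using True by linarith
  next
    case False
    define k where "k = nat \<lceil>\<gamma> * ln ?n\<rceil>"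
    have k_ge: "real k \<ge> \<gamma> * ln ?n"
      unfolding k_def by linarith
    have "\<delta> ^ Suc l * ?t \<ge> 1 \<and> real l \<le> \<delta> * ?n" if "l < k" for l
    proof
      have l: "real l \<le> \<gamma> * ln ?n"
        using that unfolding k_def by linarith
      also have "\<dots> \<le> \<delta> * ?n"
        using assms(1,3,4) n ln_pos ln_bound[of ?n] by (intro mult_mono) auto
      finally show "real l \<le> \<delta> * ?n" .
      \<comment> \<open>The choice of \<gamma> makes \<open>(1 / \<delta>) ^ l\<close> at most sqrt
        n; the factor \<open>1 / \<delta>\<close> in the threshold pays for the extra power in
        \<open>\<delta> ^ Suc l\<close>.\<close>
      have "real l * ln (1 / \<delta>) \<le> \<gamma> * ln ?n * ln (1 / \<delta>)"
        using l assms(1,2) by (intro mult_right_mono) auto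
      also have "\<dots> \<le> 1 / 2 * ln ?n"
        using mult_right_mono[OF assms(5), of "ln ?n"] ln_pos by (simp add: mult_ac)
      also have "\<dots> = ln (sqrt ?n)"
        using n by (simp add: ln_sqrt)
      finally have "ln ((1 / \<delta>) ^ l) \<le> ln (sqrt ?n)"
        using assms(1) by (simp add: ln_realpow)
      then have "(1 / \<delta>) ^ l \<le> sqrt ?n"
        using assms(1) n by (subst (asm) ln_le_cancel_iff) auto
      then have "1 \<le> \<delta> ^ l * sqrt ?n"
        using assms(1) by (simp add: field_simps)
      also have "\<dots> = \<delta> ^ Suc l * (sqrt ?n / \<delta>)"
        using assms(1) by simp
      also have "\<dots> \<le> \<delta> ^ Suc l * ?t"
        using False assms(1) by (intro mult_left_mono) auto
      finally show "\<delta> ^ Suc l * ?t \<ge> 1" .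
    qed
    \<comment> \<open>As \<open>card W\<close> is nonnegative, the k disjoint deletions of at least
      \<delta>t vertices fit into n.\<close>
    then obtain W :: "'a set" where "real (card W) + real k * \<delta> * ?t \<le> ?n"
      using exists_restriction[OF assms(1) r, of k] by blast
    moreover have "\<gamma> * ln ?n * \<delta> * ?t \<le> real k * \<delta> * ?t"
      using k_ge assms(1) by (intro mult_right_mono) auto
    ultimately have "\<gamma> * ln ?n * \<delta> * ?t \<le> 2 * ?n"
      by linarith
    then show ?thesis
      using assms(1,3) ln_pos by (simp add: field_simps)
  qed
qed

end

section \<open>Choice of constants and degenerate cases\<close>

theorem theorem1p3:
  fixes \<epsilon> :: real
  assumes "\<epsilon> > 0"
  shows "\<exists>C::real. \<forall>(V::'a set) (E::'a set set) (n::nat) (r::nat) (t::nat) (c::real).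
           RS_graph r t V E \<and> card V = n \<and> real r = c * real n \<and> 1/5 + \<epsilon> \<le> c \<and> c < 1/4
           \<longrightarrow> real t \<le> C * real n / ln (real n)"
proof -
  \<comment> \<open>The bound \<epsilon>/3 gives 13\<delta> < 5\<epsilon>, and 1/2 keeps
    \<open>ln (1 / \<delta>)\<close> positive.\<close>
  define \<delta> where "\<delta> = min (\<epsilon> / 3) (1 / 2)"
  define \<gamma> where "\<gamma> = min \<delta> (1 / (2 * ln (1 / \<delta>)))"
  have \<delta>: "0 < \<delta>" "\<delta> < 1" "13 * \<delta> < 5 * \<epsilon>"
    using assms by (auto simp: \<delta>_def min_def)
  have "ln (1 / \<delta>) > 0"
    using \<delta> by simp
  then have \<gamma>: "0 < \<gamma>" "\<gamma> \<le> \<delta>" "\<gamma> * ln (1 / \<delta>) \<le> 1 / 2"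
    using \<delta> by (auto simp: \<gamma>_def min_def field_simps)
  have "real t \<le> 2 / (\<delta> * \<gamma>) * real n / ln (real n)"
    if RS: "RS_graph r t V E" and n: "card V = n"
      and c: "real r = c * real n" "1/5 + \<epsilon> \<le> c" "c < 1/4"
    for V :: "'a set" and E n r t c
  proof -
    obtain P where P: "simple_graph V E" "partition_on E P" "card P = t"
      "\<And>M. M \<in> P \<Longrightarrow> induced_matching E M \<and> card M = r"
      using RS unfolding RS_graph_def by blast
    interpret RS_decomposition V E P r
      using P by unfold_locales auto
    show ?thesis
    \<comment> \<open>For n = 0 the right-hand side is 0, so t = 0 must be shown: then r = 0, while
      parts of a partition are nonempty. For n > 0, 0 < r < n forces n \<ge> 2.\<close>
    proof (cases "n = 0")
      case True
      have "P = {}"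
      proof (rule ccontr)
        assume "P \<noteq> {}"
        then obtain M where "M \<in> P"
          by blast
        then have "M = {}"
          using size[of M] finite_matching[of M] c True by simp
        then show False
          using \<open>M \<in> P\<close> P(2) by (simp add: partition_on_def)
      qed
      then show ?thesis
        using P(3) True by simp
    next
      case False
      have "real r > 0" "real r < real n"
        using c assms False by (auto simp: mult_less_cancel_right2)
      then have "n \<ge> 2" "r \<le> n"
        by auto
      moreover have "(1 + 13 * \<delta>) * real n < 5 * real r"
      proof -
        have "1 + 13 * \<delta> < 5 * c"
          using \<delta>(3) c(2) by linarith
        then show ?thesis
          using False c(1) by (simp add: mult_strict_right_mono flip: mult.assoc)
      qed
      ultimately show ?thesis
        using card_decomposition_le[OF \<delta>(1,2) \<gamma>] n P(3) by simp
    qed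
  qed
  then show ?thesis
    by blast
qed

end
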